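(* Let $P\subseteq\mathbb{R}^d$ be a rational polytope with non-empty interior and let $D\ge1$ be an integer upper bound for the denominator of $\mu(P)$. Let $\rho=r/s>0$ with $r,s\in\mathbb{Z}$, $s>0$, and let $P^+=\left(\rho+\frac{1}{2sD}\right)P$. (1) If $\mu(P)\le\rho$, then $P^+$ contains a dyadic fundamental domain. (2) If $\mu(P)>\rho$, then there exist $\ell\in\mathbb{Z}_{\ge0}$ and a point $c\in 2^{-\ell}\{0,\dots,2^\ell-1\}^d$ such that $P^+\cap(c+\mathbb{Z}^d)=\emptyset$.
   Context: $\mu(P)$ is the covering radius: the smallest $\rho>0$ with $\rho P+\mathbb{Z}^d=\mathbb{R}^d$. The denominator of a rational $q$ is the least positive integer $k$ with $kq\in\mathbb{Z}$. A dyadic voxel of level $\ell$ is a half-open cube $c+2^{-\ell}[0,1)^d$ with $c\in2^{-\ell}\mathbb{Z}^d$. A fundamental domain is a set containing exactly one point of each coset $p+\mathbb{Z}^d$; a dyadic fundamental domain is a fundamental domain that is a finite union of dyadic voxels. *)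

theory Defs
  imports "HOL-Analysis.Analysis" "HOL-Library.Set_Algebras"
begin

definition int_lattice :: "(real ^ 'n) set" where
  "int_lattice = {z. \<forall>i. z $ i \<in> \<int>}"

definition rational_polytope :: "(real ^ 'n) set \<Rightarrow> bool" where
  "rational_polytope P \<longleftrightarrow>
     (\<exists>V. finite V \<and> (\<forall>v\<in>V. \<forall>i. v $ i \<in> \<rat>) \<and> P = convex hull V)"

(* The sum of sets is the Minkowski sum.  The least element exists for every
   polytope with non-empty interior; otherwise the value is unspecified. *)
definition covering_radius :: "(real ^ 'n) set \<Rightarrow> real" where
  "covering_radius P = (LEAST \<rho>. 0 < \<rho> \<and> (*\<^sub>R) \<rho> ` P + int_lattice = UNIV)"

(* Meaningful for rational q only. *)
definition denominator :: "real \<Rightarrow> nat" where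
  "denominator q = (LEAST k. 0 < k \<and> real k * q \<in> \<int>)"

definition half_open_unit_cube :: "(real ^ 'n) set" where
  "half_open_unit_cube = {y. \<forall>i. 0 \<le> y $ i \<and> y $ i < 1}"

definition dyadic_voxel :: "nat \<Rightarrow> (real ^ 'n) set \<Rightarrow> bool" where
  "dyadic_voxel l Q \<longleftrightarrow>
     (\<exists>c \<in> (*\<^sub>R) (1 / 2 ^ l) ` int_lattice.
        Q = (+) c ` (*\<^sub>R) (1 / 2 ^ l) ` half_open_unit_cube)"

definition fundamental_domain :: "(real ^ 'n) set \<Rightarrow> bool" where
  "fundamental_domain F \<longleftrightarrow> (\<forall>p. \<exists>!x. x \<in> F \<inter> (+) p ` int_lattice)"

(* The voxels of the union may have different levels. *)
definition dyadic_fundamental_domain :: "(real ^ 'n) set \<Rightarrow> bool" where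
  "dyadic_fundamental_domain F \<longleftrightarrow>
     fundamental_domain F \<and>
     (\<exists>\<Q>. finite \<Q> \<and> (\<forall>Q\<in>\<Q>. \<exists>l. dyadic_voxel l Q) \<and> F = \<Union>\<Q>)"

end

theory Submission
  imports Defs
begin

text \<open>The covering radius \<open>\<mu>\<close> is rational: for bounded \<open>\<rho>\<close> only finitely many translates of
  \<open>\<rho> P\<close> meet the unit cube, so ``\<open>\<rho> P\<close> covers the torus'' is a first-order condition on \<open>\<rho>\<close> in the
  ordered \<open>\<rat>\<close>-vector space \<open>\<real>\<close>, and quantifier elimination shows that its truth value changes
  only at rational points.  Hence \<open>\<rho> < \<mu>\<close> forces \<open>\<mu> - \<rho> \<ge> 1 / (s D)\<close>, so \<open>Pplus\<close> still
  does not cover; the uncovered set is open and periodic and so contains a dyadic point.  If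
  \<open>\<mu> \<le> \<rho>\<close>, then every torus point has a representative around which a ball of uniform radius
  fits into \<open>Pplus\<close>, so each sufficiently small voxel of the unit cube can be moved into \<open>Pplus\<close> by
  an integer translation.\<close>

section \<open>Quantifier elimination for rational linear inequalities\<close>

text \<open>Functions of finitely many coordinates with rational coefficients and rational constant
  term. Terms and formulas are represented by their values, so no separate syntax is set up.\<close>

inductive rat_affine :: "(('k \<Rightarrow> real) \<Rightarrow> real) \<Rightarrow> bool" where
  const: "c \<in> \<rat> \<Longrightarrow> rat_affine (\<lambda>_. c)"
| coord: "rat_affine (\<lambda>x. x k)"
| add: "rat_affine f \<Longrightarrow> rat_affine g \<Longrightarrow> rat_affine (\<lambda>x. f x + g x)"
| scale: "c \<in> \<rat> \<Longrightarrow> rat_affine f \<Longrightarrow> rat_affine (\<lambda>x. c * f x)"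

lemma rat_affine_diff:
  assumes "rat_affine f" "rat_affine g"
  shows "rat_affine (\<lambda>x. f x - g x)"
  using rat_affine.add[OF assms(1) rat_affine.scale[OF _ assms(2), of "-1"]] by simp

lemma rat_affine_sum:
  assumes "finite A" "\<And>a. a \<in> A \<Longrightarrow> rat_affine (f a)"
  shows "rat_affine (\<lambda>x. \<Sum>a\<in>A. f a x)"
  using assms by (induction A) (auto intro: rat_affine.const rat_affine.add)

lemma rat_affine_at_0:
  assumes "rat_affine f"
  shows "f (\<lambda>_. 0) \<in> \<rat>"
  using assms by induction auto

text \<open>Isolating the coefficient of coordinate \<open>k\<close> keeps the remainder in the
  class; substituting for a variable and solving for it both rest on this.\<close>

lemma rat_affine_update:
  assumes "rat_affine f"
  shows "\<exists>a\<in>\<rat>. \<exists>g. rat_affine g \<and> (\<forall>x t. f (x(k := t)) = a * t + g x)"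
  using assms
proof induction
  case (const c)
  then show ?case
    by (intro bexI[of _ 0] exI[of _ "\<lambda>_. c"]) (auto intro: rat_affine.const)
next
  case (coord j)
  show ?case
  proof (cases "j = k")
    case True
    then show ?thesis
      by (intro bexI[of _ 1] exI[of _ "\<lambda>_. 0"]) (auto intro: rat_affine.const)
  next
    case False
    then show ?thesis
      by (intro bexI[of _ 0] exI[of _ "\<lambda>x. x j"]) (auto intro: rat_affine.coord)
  qed
next
  case (add f g)
  then obtain a f' b g' where "a \<in> \<rat>" "rat_affine f'" "\<forall>x t. f (x(k := t)) = a * t + f' x"
    "b \<in> \<rat>" "rat_affine g'" "\<forall>x t. g (x(k := t)) = b * t + g' x"
    by blast
  then show ?case
    by (intro bexI[of _ "a + b"] exI[of _ "\<lambda>x. f' x + g' x"])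
      (auto intro: rat_affine.add simp: algebra_simps simp del: fun_upd_apply)
next
  case (scale c f)
  then obtain a f' where "a \<in> \<rat>" "rat_affine f'" "\<forall>x t. f (x(k := t)) = a * t + f' x"
    by blast
  with scale.hyps show ?case
    by (intro bexI[of _ "c * a"] exI[of _ "\<lambda>x. c * f' x"])
      (auto intro: rat_affine.scale simp: algebra_simps simp del: fun_upd_apply)
qed

text \<open>The predicates definable without quantifiers. Closure of this class under a quantifier
  is therefore quantifier elimination.\<close>

inductive rat_semilinear :: "(('k \<Rightarrow> real) \<Rightarrow> bool) \<Rightarrow> bool" where
  pos: "rat_affine f \<Longrightarrow> rat_semilinear (\<lambda>x. 0 < f x)"
| neg: "rat_semilinear p \<Longrightarrow> rat_semilinear (\<lambda>x. \<not> p x)"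
| conj: "rat_semilinear p \<Longrightarrow> rat_semilinear q \<Longrightarrow> rat_semilinear (\<lambda>x. p x \<and> q x)"

lemma rat_semilinear_const: "rat_semilinear (\<lambda>_. b)"
  using rat_semilinear.pos[OF rat_affine.const[of 1]] rat_semilinear.pos[OF rat_affine.const[of 0]]
  by (cases b) auto

lemma rat_semilinear_le:
  assumes "rat_affine f" "rat_affine g"
  shows "rat_semilinear (\<lambda>x. f x \<le> g x)"
  using rat_semilinear.neg[OF rat_semilinear.pos[OF rat_affine_diff[OF assms]]]
  by (simp add: not_less)

lemma rat_semilinear_eq:
  assumes "rat_affine f" "rat_affine g"
  shows "rat_semilinear (\<lambda>x. f x = g x)"
  using rat_semilinear.conj[OF rat_semilinear_le[OF assms] rat_semilinear_le[OF assms(2,1)]]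
  by (simp add: eq_iff)

lemma rat_semilinear_disj:
  assumes "rat_semilinear p" "rat_semilinear q"
  shows "rat_semilinear (\<lambda>x. p x \<or> q x)"
  using rat_semilinear.neg[OF rat_semilinear.conj[OF assms[THEN rat_semilinear.neg]]] by simp

lemma rat_semilinear_imp:
  assumes "rat_semilinear p" "rat_semilinear q"
  shows "rat_semilinear (\<lambda>x. p x \<longrightarrow> q x)"
  unfolding imp_conv_disj by (intro rat_semilinear_disj rat_semilinear.neg assms)

lemma rat_semilinear_ball:
  assumes "finite A" "\<And>a. a \<in> A \<Longrightarrow> rat_semilinear (p a)"
  shows "rat_semilinear (\<lambda>x. \<forall>a\<in>A. p a x)"
  using assms by (induction A) (simp_all add: rat_semilinear_const rat_semilinear.conj)

lemma rat_semilinear_bex: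
  assumes "finite A" "\<And>a. a \<in> A \<Longrightarrow> rat_semilinear (p a)"
  shows "rat_semilinear (\<lambda>x. \<exists>a\<in>A. p a x)"
  using assms by (induction A) (simp_all add: rat_semilinear_const rat_semilinear_disj)

lemma rat_semilinear_subst:
  assumes "rat_semilinear p" "rat_affine g"
  shows "rat_semilinear (\<lambda>x. p (x(k := g x)))"
  using assms(1)
proof induction
  case (pos f)
  obtain a h where "a \<in> \<rat>" "rat_affine h" and *: "\<And>x t. f (x(k := t)) = a * t + h x"
    using rat_affine_update[OF pos] by metis
  with assms(2) have "rat_affine (\<lambda>x. f (x(k := g x)))"
    unfolding * by (intro rat_affine.intros)
  then show ?case by (rule rat_semilinear.pos)
qed (rule rat_semilinear.intros; assumption)+

text \<open>An atom \<open>0 < a * t + h x\<close> depends on \<open>t\<close> only through the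
  position of \<open>t\<close> relative to the root \<open>- h x / a\<close>, and not at all if
  \<open>a = 0\<close>. Boolean combinations collect the roots of their atoms.\<close>

lemma critical_points:
  assumes "rat_semilinear p"
  shows "\<exists>F. finite F \<and> (\<forall>f\<in>F. rat_affine f) \<and>
    (\<forall>x t u. (\<forall>f\<in>F. sgn (t - f x) = sgn (u - f x)) \<longrightarrow> p (x(k := t)) = p (x(k := u)))"
  using assms
proof induction
  case (pos f)
  obtain a h where a: "a \<in> \<rat>" and h: "rat_affine h" and *: "\<And>x t. f (x(k := t)) = a * t + h x"
    using rat_affine_update[OF pos] by metis
  show ?case
  proof (cases "a = 0")
    case True
    then show ?thesis by (intro exI[of _ "{}"]) (simp add: * del: fun_upd_apply)
  next
    case False
    have root: "sgn (f (x(k := t))) = sgn a * sgn (t - - (1 / a) * h x)" for x t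
      unfolding * sgn_mult[symmetric] using False by (simp add: algebra_simps)
    have pos_iff: "0 < f y \<longleftrightarrow> sgn (f y) = 1" for y
      by (simp add: sgn_1_pos)
    have "rat_affine (\<lambda>x. - (1 / a) * h x)"
      using a h by (intro rat_affine.scale) auto
    then show ?thesis
      by (intro exI[of _ "{\<lambda>x. - (1 / a) * h x}"]) (simp add: pos_iff root del: fun_upd_apply)
  qed
next
  case (neg p)
  then show ?case by (simp only: simp_thms)
next
  case (conj p q)
  from conj.IH(1) obtain F where F: "finite F \<and> (\<forall>f\<in>F. rat_affine f) \<and>
    (\<forall>x t u. (\<forall>f\<in>F. sgn (t - f x) = sgn (u - f x)) \<longrightarrow> p (x(k := t)) = p (x(k := u)))" ..
  from conj.IH(2) obtain G where G: "finite G \<and> (\<forall>f\<in>G. rat_affine f) \<and>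
    (\<forall>x t u. (\<forall>f\<in>G. sgn (t - f x) = sgn (u - f x)) \<longrightarrow> q (x(k := t)) = q (x(k := u)))" ..
  show ?case
  proof (intro exI[of _ "F \<union> G"] conjI allI impI)
    fix x t u assume *: "\<forall>f\<in>F \<union> G. sgn (t - f x) = sgn (u - f x)"
    have "p (x(k := t)) = p (x(k := u))" using F * by simp
    moreover have "q (x(k := t)) = q (x(k := u))" using G * by simp
    ultimately show "(p (x(k := t)) \<and> q (x(k := t))) = (p (x(k := u)) \<and> q (x(k := u)))"
      by simp
  qed (use F G in auto)
qed

text \<open>The sign pattern is constant on each point of \<open>A\<close> and on each open interval
  between them. A point of \<open>A\<close> is the midpoint of itself with itself, a bounded
  interval contains the midpoint of its ends, an unbounded one a point at distance 1 from its end,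
  and 0 serves when \<open>A\<close> is empty.\<close>

lemma sgn_pattern_witness:
  fixes t :: real
  assumes "finite A"
  obtains u where "u = 0 \<or> (\<exists>a\<in>A. u = a - 1) \<or> (\<exists>a\<in>A. u = a + 1) \<or> (\<exists>a\<in>A. \<exists>b\<in>A. u = (a + b) / 2)"
    and "\<forall>a\<in>A. sgn (t - a) = sgn (u - a)"
proof (cases "t \<in> A")
  case True
  then have "\<exists>a\<in>A. \<exists>b\<in>A. t = (a + b) / 2" by (intro bexI[of _ t]) auto
  then show ?thesis using that by blast
next
  case False
  define L U where "L = {a \<in> A. a < t}" and "U = {a \<in> A. t < a}"
  have fin: "finite L" "finite U"
    using assms by (auto simp: L_def U_def)
  have A: "a \<in> L \<or> a \<in> U" if "a \<in> A" for a
    using that False by (cases a t rule: linorder_cases) (auto simp: L_def U_def)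
  have sgns: "\<forall>a\<in>A. sgn (t - a) = sgn (u - a)"
    if "\<And>a. a \<in> L \<Longrightarrow> a < u" "\<And>a. a \<in> U \<Longrightarrow> u < a" for u
  proof
    fix a assume "a \<in> A"
    then consider "a \<in> L" | "a \<in> U" using A by blast
    then show "sgn (t - a) = sgn (u - a)"
      by cases (use that[of a] in \<open>auto simp: L_def U_def sgn_if\<close>)
  qed
  have L: "Max L \<in> A" "\<And>a. a \<in> L \<Longrightarrow> a \<le> Max L" "Max L < t" if "L \<noteq> {}"
    using Max_in[OF fin(1) that] fin by (auto simp: L_def)
  have U: "Min U \<in> A" "\<And>a. a \<in> U \<Longrightarrow> Min U \<le> a" "t < Min U" if "U \<noteq> {}"
    using Min_in[OF fin(2) that] fin by (auto simp: U_def)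
  consider "L = {}" "U = {}" | "L = {}" "U \<noteq> {}" | "L \<noteq> {}" "U = {}" | "L \<noteq> {}" "U \<noteq> {}"
    by blast
  then show ?thesis
  proof cases
    case 1
    then show ?thesis using sgns[of 0] that by blast
  next
    case 2
    have "Min U - 1 < a" if "a \<in> U" for a
      using U(2)[OF 2(2) that] by simp
    then show ?thesis using sgns[of "Min U - 1"] 2 U(1) that by blast
  next
    case 3
    have "a < Max L + 1" if "a \<in> L" for a
      using L(2)[OF 3(1) that] by simp
    then show ?thesis using sgns[of "Max L + 1"] 3 L(1) that by blast
  next
    case 4
    let ?u = "(Max L + Min U) / 2"
    have "a < ?u" if "a \<in> L" for a
      using L(2)[OF 4(1) that] L(3)[OF 4(1)] U(3)[OF 4(2)] by simp
    moreover have "?u < a" if "a \<in> U" for a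
      using U(2)[OF 4(2) that] L(3)[OF 4(1)] U(3)[OF 4(2)] by simp
    ultimately show ?thesis using sgns[of ?u] L(1)[OF 4(1)] U(1)[OF 4(2)] that by blast
  qed
qed

text \<open>Ferrante--Rackoff elimination: finitely many test points, affine in \<open>x\<close>, realise all sign patterns.\<close>

lemma rat_semilinear_ex_update:
  assumes "rat_semilinear p"
  shows "rat_semilinear (\<lambda>x. \<exists>t. p (x(k := t)))"
proof -
  obtain F where F: "finite F" "\<And>f. f \<in> F \<Longrightarrow> rat_affine f"
    and crit: "\<And>x t u. (\<forall>f\<in>F. sgn (t - f x) = sgn (u - f x)) \<Longrightarrow> p (x(k := t)) = p (x(k := u))"
    using critical_points[OF assms, of k] by metis
  define G where "G = insert (\<lambda>_. 0) ((\<lambda>f x. f x - 1) ` F \<union> (\<lambda>f x. f x + 1) ` F \<union>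
    (\<lambda>(f, g) x. 1 / 2 * (f x + g x)) ` (F \<times> F))"
  have "finite G" using F(1) by (simp add: G_def)
  moreover have "rat_affine (\<lambda>x. 1 / 2 * (f x + g x))" if "f \<in> F" "g \<in> F" for f g
    using that F(2) by (intro rat_affine.intros) auto
  then have "rat_affine g" if "g \<in> G" for g
    using that F(2)
    by (auto simp: G_def simp del: times_divide_eq_left intro!: rat_affine_diff rat_affine.intros)
  ultimately have "rat_semilinear (\<lambda>x. \<exists>g\<in>G. p (x(k := g x)))"
    using assms by (intro rat_semilinear_bex rat_semilinear_subst)
  moreover have "(\<exists>t. p (x(k := t))) \<longleftrightarrow> (\<exists>g\<in>G. p (x(k := g x)))" for x
  proof
    assume "\<exists>t. p (x(k := t))"
    then obtain t where t: "p (x(k := t))" by blast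
    obtain u where u: "u = 0 \<or> (\<exists>f\<in>F. u = f x - 1) \<or> (\<exists>f\<in>F. u = f x + 1) \<or>
        (\<exists>f\<in>F. \<exists>g\<in>F. u = 1 / 2 * (f x + g x))"
      and sgns: "\<forall>f\<in>F. sgn (t - f x) = sgn (u - f x)"
      using sgn_pattern_witness[of "(\<lambda>f. f x) ` F" t] F(1) by auto
    from u have "\<exists>g\<in>G. g x = u"
      unfolding G_def by (elim disjE bexE) (simp_all add: bex_Un; blast)+
    with sgns obtain g where "g \<in> G" "\<forall>f\<in>F. sgn (t - f x) = sgn (g x - f x)"
      by blast
    then show "\<exists>g\<in>G. p (x(k := g x))" using t crit by blast
  qed blast
  ultimately show ?thesis by simp
qed

text \<open>Letting \<open>y\<close> differ from \<open>x\<close> only on \<open>K\<close> expresses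
  a block of existential quantifiers, which is eliminated one variable at a time.\<close>

lemma rat_semilinear_ex:
  assumes "finite K" "rat_semilinear p"
  shows "rat_semilinear (\<lambda>x. \<exists>y. (\<forall>k. k \<notin> K \<longrightarrow> y k = x k) \<and> p y)"
  using assms(1)
proof induction
  case empty
  have "(\<lambda>x. \<exists>y. (\<forall>k. k \<notin> {} \<longrightarrow> y k = x k) \<and> p y) = p"
    by (auto simp: fun_eq_iff[symmetric])
  then show ?case using assms(2) by simp
next
  case (insert k K)
  have "(\<exists>y. (\<forall>j. j \<notin> insert k K \<longrightarrow> y j = x j) \<and> p y) \<longleftrightarrow>
    (\<exists>t y. (\<forall>j. j \<notin> K \<longrightarrow> y j = (x(k := t)) j) \<and> p y)" for x
  proof
    assume "\<exists>y. (\<forall>j. j \<notin> insert k K \<longrightarrow> y j = x j) \<and> p y"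
    then obtain y where "\<forall>j. j \<notin> insert k K \<longrightarrow> y j = x j" "p y" by blast
    then show "\<exists>t y. (\<forall>j. j \<notin> K \<longrightarrow> y j = (x(k := t)) j) \<and> p y"
      by (intro exI[of _ "y k"] exI[of _ y]) auto
  next
    assume "\<exists>t y. (\<forall>j. j \<notin> K \<longrightarrow> y j = (x(k := t)) j) \<and> p y"
    then obtain t y where "\<forall>j. j \<notin> K \<longrightarrow> y j = (x(k := t)) j" "p y" by blast
    then show "\<exists>y. (\<forall>j. j \<notin> insert k K \<longrightarrow> y j = x j) \<and> p y"
      by (intro exI[of _ y]) auto
  qed
  then show ?case using rat_semilinear_ex_update[OF insert.IH, of k] by simp
qed

lemma rat_semilinear_all:
  assumes "finite K" "rat_semilinear p"
  shows "rat_semilinear (\<lambda>x. \<forall>y. (\<forall>k. k \<notin> K \<longrightarrow> y k = x k) \<longrightarrow> p y)"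
  using rat_semilinear.neg[OF rat_semilinear_ex[OF assms(1) rat_semilinear.neg[OF assms(2)]]]
  by (simp only: not_ex de_Morgan_conj not_not imp_conv_disj)

text \<open>At the zero assignment the critical functions become rational constants, so along one
  axis the truth value can change only at finitely many rational points.\<close>

lemma rat_semilinear_one_variable:
  assumes "rat_semilinear p"
  shows "\<exists>A. finite A \<and> A \<subseteq> \<rat> \<and> (\<forall>t u. (\<forall>a\<in>A. sgn (t - a) = sgn (u - a)) \<longrightarrow>
    p ((\<lambda>_. 0)(k := t)) = p ((\<lambda>_. 0)(k := u)))"
proof -
  obtain F where F: "finite F" "\<And>f. f \<in> F \<Longrightarrow> rat_affine f"
    and crit: "\<And>x t u. (\<forall>f\<in>F. sgn (t - f x) = sgn (u - f x)) \<Longrightarrow> p (x(k := t)) = p (x(k := u))"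
    using critical_points[OF assms, of k] by metis
  have "(\<lambda>f. f (\<lambda>_. 0)) ` F \<subseteq> \<rat>"
    using F(2) rat_affine_at_0 by blast
  then show ?thesis
    using F(1) crit by (intro exI[of _ "(\<lambda>f. f (\<lambda>_. 0)) ` F"]) auto
qed

section \<open>The covering condition\<close>

lemma zero_in_int_lattice: "0 \<in> int_lattice"
  by (simp add: int_lattice_def)

lemma add_in_int_lattice: "x \<in> int_lattice \<Longrightarrow> y \<in> int_lattice \<Longrightarrow> x + y \<in> int_lattice"
  by (simp add: int_lattice_def)

lemma diff_in_int_lattice: "x \<in> int_lattice \<Longrightarrow> y \<in> int_lattice \<Longrightarrow> x - y \<in> int_lattice"
  by (simp add: int_lattice_def)

lemma closed_int_lattice: "closed (int_lattice :: (real ^ 'n) set)"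
proof -
  have "closed ((\<lambda>z :: real ^ 'n. z $ i) -` \<int>)" for i
    by (intro closed_vimage closed_Ints continuous_intros)
  then have "closed (\<Inter>i. (\<lambda>z :: real ^ 'n. z $ i) -` \<int>)"
    by blast
  also have "(\<Inter>i. (\<lambda>z :: real ^ 'n. z $ i) -` \<int>) = int_lattice"
    by (auto simp: int_lattice_def)
  finally show ?thesis .
qed

lemma finite_vec_image:
  assumes "finite A"
  shows "finite {z :: 'a ^ 'n. \<forall>i. z $ i \<in> A}"
proof -
  have "finite (UNIV \<rightarrow>\<^sub>E A :: ('n \<Rightarrow> 'a) set)"
    by (intro finite_PiE assms) auto
  moreover have "{z :: 'a ^ 'n. \<forall>i. z $ i \<in> A} \<subseteq> vec_lambda ` (UNIV \<rightarrow>\<^sub>E A)"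
  proof
    fix z :: "'a ^ 'n" assume "z \<in> {z. \<forall>i. z $ i \<in> A}"
    then have "vec_nth z \<in> UNIV \<rightarrow>\<^sub>E A" by auto
    then have "vec_lambda (vec_nth z) \<in> vec_lambda ` (UNIV \<rightarrow>\<^sub>E A)" by (rule imageI)
    then show "z \<in> vec_lambda ` (UNIV \<rightarrow>\<^sub>E A)" by simp
  qed
  ultimately show ?thesis by (meson finite_imageI finite_subset)
qed

lemma finite_int_lattice_bounded: "finite {z \<in> int_lattice. norm z \<le> B}"
proof -
  let ?A = "real_of_int ` {- \<lceil>B\<rceil>..\<lceil>B\<rceil>}"
  have "{z :: real ^ 'n. z \<in> int_lattice \<and> norm z \<le> B} \<subseteq> {z. \<forall>i. z $ i \<in> ?A}"
  proof safe
    fix z :: "real ^ 'n" and i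
    assume "z \<in> int_lattice" and B: "norm z \<le> B"
    then obtain k where k: "z $ i = of_int k" by (auto simp: int_lattice_def Ints_def)
    have "\<bar>real_of_int k\<bar> \<le> B" using component_le_norm_cart[of z i] B k by simp
    then have "k \<in> {- \<lceil>B\<rceil>..\<lceil>B\<rceil>}" by (simp add: abs_le_iff) linarith
    then show "z $ i \<in> ?A" using k by blast
  qed
  then show ?thesis by (rule finite_subset) (intro finite_vec_image finite_imageI finite_atLeastAtMost_int)
qed

text \<open>The representative of the coset of \<open>x\<close> modulo the integer lattice in the
  half-open unit cube.\<close>

definition frac_vec :: "real ^ 'n \<Rightarrow> real ^ 'n" where
  "frac_vec x = (\<chi> i. frac (x $ i))"

lemma diff_frac_vec: "x - frac_vec x \<in> int_lattice"
  by (simp add: int_lattice_def frac_vec_def frac_def)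

lemma frac_vec_in_cube: "frac_vec x \<in> half_open_unit_cube"
  by (simp add: half_open_unit_cube_def frac_vec_def frac_lt_1)

lemma frac_vec_unique:
  assumes "y \<in> half_open_unit_cube" "x - y \<in> int_lattice"
  shows "frac_vec x = y"
proof -
  have "frac (x $ i) = y $ i" for i
    using assms by (subst frac_unique_iff) (auto simp: half_open_unit_cube_def int_lattice_def)
  then show ?thesis by (simp add: frac_vec_def vec_eq_iff)
qed

lemma norm_scaled_cube_le:
  assumes "y \<in> half_open_unit_cube" "0 \<le> a"
  shows "norm (a *\<^sub>R y :: real ^ 'n) \<le> a * CARD('n)"
proof -
  have "norm y \<le> (\<Sum>i\<in>UNIV. \<bar>y $ i\<bar>)" by (rule norm_le_l1_cart)
  also have "\<dots> \<le> (\<Sum>i\<in>(UNIV :: 'n set). 1)"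
    using assms by (intro sum_mono) (simp add: half_open_unit_cube_def less_imp_le)
  finally show ?thesis using assms(2) by (simp add: mult_left_mono)
qed

section \<open>Covering by dilates and the least covering scale\<close>

definition covers :: "(real ^ 'n) set \<Rightarrow> real \<Rightarrow> bool" where
  "covers P \<rho> \<longleftrightarrow> (\<forall>p. \<exists>y\<in>P. p - \<rho> *\<^sub>R y \<in> int_lattice)"

lemma covers_iff: "covers P \<rho> \<longleftrightarrow> (*\<^sub>R) \<rho> ` P + int_lattice = UNIV"
proof
  assume *: "covers P \<rho>"
  have "p \<in> (*\<^sub>R) \<rho> ` P + int_lattice" for p
  proof -
    obtain y where "y \<in> P" "p - \<rho> *\<^sub>R y \<in> int_lattice"
      using * by (auto simp: covers_def)
    then have "\<rho> *\<^sub>R y + (p - \<rho> *\<^sub>R y) \<in> (*\<^sub>R) \<rho> ` P + int_lattice"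
      by (intro set_plus_intro imageI)
    then show ?thesis by simp
  qed
  then show "(*\<^sub>R) \<rho> ` P + int_lattice = UNIV" by blast
next
  assume *: "(*\<^sub>R) \<rho> ` P + int_lattice = UNIV"
  show "covers P \<rho>" unfolding covers_def
  proof
    fix p
    have "p \<in> (*\<^sub>R) \<rho> ` P + int_lattice" using * by simp
    then obtain y b where "y \<in> P" "b \<in> int_lattice" "p = \<rho> *\<^sub>R y + b"
      by (auto elim!: set_plus_elim)
    then show "\<exists>y\<in>P. p - \<rho> *\<^sub>R y \<in> int_lattice"
      by (intro bexI[of _ y]) auto
  qed
qed

lemma covers_cubeI:
  assumes "\<And>p. p \<in> half_open_unit_cube \<Longrightarrow> \<exists>y\<in>P. p - \<rho> *\<^sub>R y \<in> int_lattice"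
  shows "covers P \<rho>"
  unfolding covers_def
proof
  fix p
  obtain y where "y \<in> P" "frac_vec p - \<rho> *\<^sub>R y \<in> int_lattice"
    using assms frac_vec_in_cube by blast
  then have "(p - frac_vec p) + (frac_vec p - \<rho> *\<^sub>R y) \<in> int_lattice"
    by (intro add_in_int_lattice diff_frac_vec)
  then show "\<exists>y\<in>P. p - \<rho> *\<^sub>R y \<in> int_lattice" using \<open>y \<in> P\<close> by (intro bexI[of _ y]) simp
qed

text \<open>Enlarging the scale by \<open>\<eta>\<close> adds \<open>\<eta> P\<close>, which contains a ball.\<close>

lemma covers_thicken:
  fixes P :: "(real ^ 'n) set"
  assumes "convex P" "interior P \<noteq> {}" "0 \<le> a" "0 < \<eta>" "covers P a"
  obtains \<delta> where "0 < \<delta>" and "\<And>p. \<exists>z\<in>int_lattice. ball (p + z) \<delta> \<subseteq> (*\<^sub>R) (a + \<eta>) ` P"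
proof -
  obtain x0 r where r: "0 < r" and ball: "ball x0 r \<subseteq> P"
    using assms(2) by (metis ex_in_conv mem_interior)
  have "\<exists>z\<in>int_lattice. ball (p + z) (\<eta> * r) \<subseteq> (*\<^sub>R) (a + \<eta>) ` P" for p
  proof -
    \<comment> \<open>Covering the shifted point \<open>p - \<eta> *\<^sub>R x0\<close> makes
      \<open>p + z\<close> the centre of \<open>a *\<^sub>R y\<close> plus the
      \<open>\<eta>\<close>-dilate of the ball in \<open>P\<close>. By convexity this ball lies in
      the dilate of \<open>P\<close> by \<open>a + \<eta>\<close>.\<close>
    obtain y where y: "y \<in> P" and lat: "(p - \<eta> *\<^sub>R x0) - a *\<^sub>R y \<in> int_lattice"
      using assms(5) by (auto simp: covers_def)
    define z where "z = - ((p - \<eta> *\<^sub>R x0) - a *\<^sub>R y)"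
    have z: "z \<in> int_lattice"
      using diff_in_int_lattice[OF zero_in_int_lattice lat] by (simp add: z_def)
    have pz: "p + z = a *\<^sub>R y + \<eta> *\<^sub>R x0" by (simp add: z_def)
    have "u \<in> (*\<^sub>R) (a + \<eta>) ` P" if "u \<in> ball (p + z) (\<eta> * r)" for u
    proof -
      define x1 where "x1 = (1 / \<eta>) *\<^sub>R (u - a *\<^sub>R y)"
      have "x1 - x0 = (1 / \<eta>) *\<^sub>R (u - (p + z))"
        using assms(4) by (simp add: x1_def pz algebra_simps)
      then have "norm (x1 - x0) = norm (u - (p + z)) / \<eta>"
        using assms(4) by simp
      also have "\<dots> < r"
        using that assms(4) by (simp add: dist_norm norm_minus_commute pos_divide_less_eq mult.commute)
      finally have "x1 \<in> P"
        using ball by (auto simp: dist_norm norm_minus_commute)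
      then have "(a / (a + \<eta>)) *\<^sub>R y + (\<eta> / (a + \<eta>)) *\<^sub>R x1 \<in> P"
        using assms(1,3,4) y by (intro convexD) (auto simp: add_divide_distrib[symmetric])
      moreover have "u = (a + \<eta>) *\<^sub>R ((a / (a + \<eta>)) *\<^sub>R y + (\<eta> / (a + \<eta>)) *\<^sub>R x1)"
        using assms(3,4) by (simp add: scaleR_add_right x1_def)
      ultimately show ?thesis by blast
    qed
    then show ?thesis using z by blast
  qed
  moreover have "0 < \<eta> * r" using r assms(4) by simp
  ultimately show ?thesis using that by blast
qed

text \<open>The dilate by \<open>R\<close> of a ball of radius \<open>r\<close> in \<open>P\<close>
  has radius \<open>CARD('n) + 1\<close>, so it contains the translate of the unit cube whose corner
  is its centre.\<close>

lemma covers_large: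
  fixes P :: "(real ^ 'n) set"
  assumes "interior P \<noteq> {}"
  obtains R where "0 < R" "covers P R"
proof -
  obtain x0 r where r: "0 < r" and ball: "ball x0 r \<subseteq> P"
    using assms by (metis ex_in_conv mem_interior)
  define R where "R = (real CARD('n) + 1) / r"
  have R: "0 < R" using r by (simp add: R_def)
  have "covers P R"
    unfolding covers_def
  proof
    fix p
    define f where "f = frac_vec (p - R *\<^sub>R x0)"
    have "norm ((1 / R) *\<^sub>R f) \<le> 1 / R * CARD('n)"
      unfolding f_def using R by (intro norm_scaled_cube_le frac_vec_in_cube) simp
    also have "\<dots> < r" using r by (simp add: R_def field_simps)
    finally have "x0 + (1 / R) *\<^sub>R f \<in> P"
      using ball by (auto simp: dist_norm)
    moreover have "p - R *\<^sub>R (x0 + (1 / R) *\<^sub>R f) = (p - R *\<^sub>R x0) - f"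
      using R by (simp add: scaleR_add_right)
    ultimately show "\<exists>y\<in>P. p - R *\<^sub>R y \<in> int_lattice"
      unfolding f_def using diff_frac_vec by metis
  qed
  with R show ?thesis using that by blast
qed

text \<open>If \<open>B\<close> bounds the norms in \<open>P\<close>, a lattice vector that brings a
  dilate to the cube has norm at most \<open>CARD('n) + R * B\<close>. That \<open>Z\<close> is the
  same for all scales up to \<open>R\<close> turns the lattice quantifier into one finite
  disjunction.\<close>

lemma covers_finite_lattice:
  fixes P :: "(real ^ 'n) set"
  assumes "bounded P"
  obtains Z where "finite Z" "Z \<subseteq> int_lattice"
    "\<And>\<rho>. 0 \<le> \<rho> \<Longrightarrow> \<rho> \<le> R \<Longrightarrow>
      covers P \<rho> \<longleftrightarrow> (\<forall>p\<in>half_open_unit_cube. \<exists>z\<in>Z. \<exists>y\<in>P. p = \<rho> *\<^sub>R y + z)"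
proof -
  obtain B where B: "\<And>y. y \<in> P \<Longrightarrow> norm y \<le> B"
    using assms by (auto simp: bounded_iff)
  define Z where "Z = {z \<in> int_lattice :: (real ^ 'n) set. norm z \<le> CARD('n) + R * B}"
  have "covers P \<rho> \<longleftrightarrow> (\<forall>p\<in>half_open_unit_cube. \<exists>z\<in>Z. \<exists>y\<in>P. p = \<rho> *\<^sub>R y + z)"
    if \<rho>: "0 \<le> \<rho>" "\<rho> \<le> R" for \<rho>
  proof
    assume cov: "covers P \<rho>"
    show "\<forall>p\<in>half_open_unit_cube. \<exists>z\<in>Z. \<exists>y\<in>P. p = \<rho> *\<^sub>R y + z"
    proof
      fix p :: "real ^ 'n" assume p: "p \<in> half_open_unit_cube"
      obtain y where y: "y \<in> P" and lat: "p - \<rho> *\<^sub>R y \<in> int_lattice"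
        using cov by (auto simp: covers_def)
      have "norm (p - \<rho> *\<^sub>R y) \<le> norm p + \<rho> * norm y"
        using norm_triangle_ineq4[of p "\<rho> *\<^sub>R y"] \<rho> by simp
      also have "\<dots> \<le> CARD('n) + R * B"
        using norm_scaled_cube_le[OF p, of 1] B[OF y] \<rho> by (intro add_mono mult_mono) auto
      finally have "p - \<rho> *\<^sub>R y \<in> Z" using lat by (simp add: Z_def)
      then show "\<exists>z\<in>Z. \<exists>y\<in>P. p = \<rho> *\<^sub>R y + z"
        using y by (intro bexI[of _ "p - \<rho> *\<^sub>R y"] bexI[of _ y]) auto
    qed
  next
    assume *: "\<forall>p\<in>half_open_unit_cube. \<exists>z\<in>Z. \<exists>y\<in>P. p = \<rho> *\<^sub>R y + z"
    show "covers P \<rho>"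
    proof (rule covers_cubeI)
      fix p :: "real ^ 'n" assume "p \<in> half_open_unit_cube"
      then obtain z y where "z \<in> Z" "y \<in> P" "p = \<rho> *\<^sub>R y + z" using * by blast
      then show "\<exists>y\<in>P. p - \<rho> *\<^sub>R y \<in> int_lattice"
        by (intro bexI[of _ y]) (auto simp: Z_def)
    qed
  qed
  then show ?thesis
    using that[of Z] finite_int_lattice_bounded by (auto simp: Z_def)
qed

text \<open>Among the scales in \<open>{0..R}\<close>, those that cover form an intersection over
  points of finite unions of closed sets. This set is compact and contains \<open>R\<close>, so it
  has a minimum, and the \<open>LEAST\<close> in \<open>covering_radius\<close> is attained.\<close>

lemma least_cover:
  fixes P :: "(real ^ 'n) set"
  assumes "compact P" "interior P \<noteq> {}"
  shows "0 < covering_radius P" "covers P (covering_radius P)"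
    "\<And>\<rho>. 0 < \<rho> \<Longrightarrow> covers P \<rho> \<Longrightarrow> covering_radius P \<le> \<rho>"
proof -
  obtain R where R: "0 < R" "covers P R" using covers_large[OF assms(2)] .
  obtain Z where Z: "finite Z" "Z \<subseteq> int_lattice"
    and cov: "\<And>\<rho>. 0 \<le> \<rho> \<Longrightarrow> \<rho> \<le> R \<Longrightarrow>
      covers P \<rho> \<longleftrightarrow> (\<forall>p\<in>half_open_unit_cube. \<exists>z\<in>Z. \<exists>y\<in>P. p = \<rho> *\<^sub>R y + z)"
    using covers_finite_lattice[OF compact_imp_bounded[OF assms(1)], where R = R] by metis
  \<comment> \<open>The scales up to \<open>R\<close> whose dilate contains \<open>q\<close>,
    written as the projection of a compact subset of \<open>{0..R} \<times> P\<close> so that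
    closedness is immediate.\<close>
  define S where "S q = fst ` (({0..R} \<times> P) \<inter> {w. fst w *\<^sub>R snd w = q})" for q
  have S: "\<rho> \<in> S q \<longleftrightarrow> 0 \<le> \<rho> \<and> \<rho> \<le> R \<and> (\<exists>y\<in>P. q = \<rho> *\<^sub>R y)" for \<rho> q
    by (force simp: S_def)
  have "closed (S q)" for q
    unfolding S_def
    by (intro compact_imp_closed compact_continuous_image compact_Int_closed compact_Times
        closed_Collect_eq continuous_intros assms) auto
  then have "closed ({0..R} \<inter> (\<Inter>p\<in>half_open_unit_cube. \<Union>z\<in>Z. S (p - z)))"
    using Z(1) by (intro closed_Int closed_INT closed_UN) auto
  moreover have "{0..R} \<inter> (\<Inter>p\<in>half_open_unit_cube. \<Union>z\<in>Z. S (p - z)) = {\<rho>. 0 \<le> \<rho> \<and> \<rho> \<le> R \<and> covers P \<rho>}"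
    using cov by (auto simp: S diff_eq_eq)
  ultimately have "closed {\<rho>. 0 \<le> \<rho> \<and> \<rho> \<le> R \<and> covers P \<rho>}" by simp
  moreover have "bounded {\<rho>. 0 \<le> \<rho> \<and> \<rho> \<le> R \<and> covers P \<rho>}"
    by (rule bounded_subset[of "{0..R}"]) auto
  ultimately have "compact {\<rho>. 0 \<le> \<rho> \<and> \<rho> \<le> R \<and> covers P \<rho>}"
    by (simp add: compact_eq_bounded_closed)
  moreover have "R \<in> {\<rho>. 0 \<le> \<rho> \<and> \<rho> \<le> R \<and> covers P \<rho>}" using R by simp
  ultimately obtain m where m: "0 \<le> m" "m \<le> R" "covers P m"
    and min: "\<And>\<rho>. 0 \<le> \<rho> \<Longrightarrow> \<rho> \<le> R \<Longrightarrow> covers P \<rho> \<Longrightarrow> m \<le> \<rho>"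
    using compact_attains_inf[of "{\<rho>. 0 \<le> \<rho> \<and> \<rho> \<le> R \<and> covers P \<rho>}"] by auto
  have "m \<noteq> 0"
  proof
    assume "m = 0"
    then have "((\<chi> i. 1 / 2) :: real ^ 'n) \<in> int_lattice"
      using m(3) by (auto simp: covers_def)
    then have "frac (1 / 2 :: real) = 0" by (simp add: int_lattice_def frac_eq_0_iff)
    moreover have "frac (1 / 2 :: real) = 1 / 2" by (subst frac_unique_iff) auto
    ultimately show False by simp
  qed
  then have pos: "0 < m" using m(1) by simp
  have "covering_radius P = m"
    unfolding covering_radius_def covers_iff[symmetric]
  proof (rule Least_equality)
    show "m \<le> \<rho>" if "0 < \<rho> \<and> covers P \<rho>" for \<rho>
      using that min[of \<rho>] m(2) by (cases "\<rho> \<le> R") auto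
  qed (use pos m in auto)
  then show "0 < covering_radius P" "covers P (covering_radius P)"
    "\<And>\<rho>. 0 < \<rho> \<Longrightarrow> covers P \<rho> \<Longrightarrow> covering_radius P \<le> \<rho>"
    using pos m min by (auto, meson le_cases less_imp_le order_trans)
qed

section \<open>Rationality of the covering radius\<close>

text \<open>Index type of the covering formula: the free scale, the universally quantified
  coordinates of the point, and the existentially quantified convex weights.\<close>

datatype ('i, 'v) variable = Scale | Point 'i | Weight 'v

text \<open>Absorbing \<open>\<rho>\<close> into the convex weights, which then sum to
  \<open>\<rho>\<close>, removes the product of two variables. The condition becomes linear in
  scale, point and weights jointly, with coefficients taken from the vertices.\<close>

lemma mem_scaled_hull_iff:
  fixes V :: "(real ^ 'n) set"
  assumes "finite V" "0 < \<rho>"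
  shows "(\<exists>y\<in>convex hull V. q = \<rho> *\<^sub>R y) \<longleftrightarrow>
    (\<exists>u. (\<forall>v\<in>V. 0 \<le> u v) \<and> sum u V = \<rho> \<and> (\<forall>i. q $ i = (\<Sum>v\<in>V. v $ i * u v)))"
proof
  assume "\<exists>y\<in>convex hull V. q = \<rho> *\<^sub>R y"
  then obtain u where u: "\<forall>v\<in>V. 0 \<le> u v" "sum u V = 1" "q = \<rho> *\<^sub>R (\<Sum>v\<in>V. u v *\<^sub>R v)"
    by (auto simp: convex_hull_finite[OF assms(1)])
  have "(\<Sum>v\<in>V. \<rho> * u v) = \<rho>" using u(2) by (simp add: sum_distrib_left[symmetric])
  moreover have "q $ i = (\<Sum>v\<in>V. v $ i * (\<rho> * u v))" for i
    unfolding u(3) by (simp add: sum_distrib_left mult_ac)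
  ultimately show "\<exists>u. (\<forall>v\<in>V. 0 \<le> u v) \<and> sum u V = \<rho> \<and> (\<forall>i. q $ i = (\<Sum>v\<in>V. v $ i * u v))"
    using assms(2) u(1) by (intro exI[of _ "\<lambda>v. \<rho> * u v"]) simp
next
  assume "\<exists>u. (\<forall>v\<in>V. 0 \<le> u v) \<and> sum u V = \<rho> \<and> (\<forall>i. q $ i = (\<Sum>v\<in>V. v $ i * u v))"
  then obtain u where u: "\<forall>v\<in>V. 0 \<le> u v" "sum u V = \<rho>" "\<forall>i. q $ i = (\<Sum>v\<in>V. v $ i * u v)"
    by blast
  have "(\<Sum>v\<in>V. (u v / \<rho>) *\<^sub>R v) \<in> convex hull V"
    unfolding convex_hull_finite[OF assms(1)] using u assms(2)
    by (auto intro!: exI[of _ "\<lambda>v. u v / \<rho>"] simp: sum_divide_distrib[symmetric])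
  moreover have "q = \<rho> *\<^sub>R (\<Sum>v\<in>V. (u v / \<rho>) *\<^sub>R v)"
    using assms(2) by (simp add: vec_eq_iff u(3) scaleR_sum_right mult_ac)
  ultimately show "\<exists>y\<in>convex hull V. q = \<rho> *\<^sub>R y" by blast
qed

text \<open>\<open>\<Theta>\<close> is the quantifier-free matrix for one translation
  \<open>z\<close>, \<open>\<Psi>\<close> adds the finite choice of \<open>z\<close> and the
  weights, and \<open>\<Phi>\<close> quantifies over the points of the cube. Rational vertices and
  integral \<open>z\<close> make all coefficients rational.\<close>

lemma covering_condition_semilinear:
  fixes V Z :: "(real ^ 'n) set"
  assumes "finite V" "\<And>v i. v \<in> V \<Longrightarrow> v $ i \<in> \<rat>" "finite Z" "Z \<subseteq> int_lattice"
  obtains \<Phi> :: "(('n, real ^ 'n) variable \<Rightarrow> real) \<Rightarrow> bool" where "rat_semilinear \<Phi>"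
    "\<And>\<rho>. 0 < \<rho> \<Longrightarrow> \<Phi> ((\<lambda>_. 0)(Scale := \<rho>)) \<longleftrightarrow>
      (\<forall>p\<in>half_open_unit_cube. \<exists>z\<in>Z. \<exists>y\<in>convex hull V. p = \<rho> *\<^sub>R y + z)"
proof -
  define \<Theta> where "\<Theta> z w \<longleftrightarrow> (\<forall>v\<in>V. 0 \<le> w (Weight v)) \<and> (\<Sum>v\<in>V. w (Weight v)) = w Scale \<and>
      (\<forall>i\<in>UNIV. w (Point i) = (\<Sum>v\<in>V. v $ i * w (Weight v)) + z $ i)"
    for z :: "real ^ 'n" and w :: "('n, real ^ 'n) variable \<Rightarrow> real"
  define \<Psi> where "\<Psi> y \<longleftrightarrow> (\<exists>z\<in>Z. \<exists>w. (\<forall>k. k \<notin> Weight ` V \<longrightarrow> w k = y k) \<and> \<Theta> z w)"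
    for y :: "('n, real ^ 'n) variable \<Rightarrow> real"
  define \<Phi> where "\<Phi> x \<longleftrightarrow> (\<forall>y. (\<forall>k. k \<notin> range Point \<longrightarrow> y k = x k) \<longrightarrow>
      (\<forall>i\<in>UNIV. 0 \<le> y (Point i) \<and> 0 < 1 - y (Point i)) \<longrightarrow> \<Psi> y)"
    for x :: "('n, real ^ 'n) variable \<Rightarrow> real"
  have "rat_semilinear (\<Theta> z)" if "z \<in> Z" for z
    unfolding \<Theta>_def using that assms
    by (intro rat_semilinear.conj rat_semilinear_ball rat_semilinear_le rat_semilinear_eq
        rat_affine_sum rat_affine.intros finite_UNIV)
      (auto simp: int_lattice_def elim!: subsetD[OF Ints_subset_Rats])
  then have "rat_semilinear \<Psi>"
    unfolding \<Psi>_def using assms by (intro rat_semilinear_bex rat_semilinear_ex) auto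
  then have "rat_semilinear \<Phi>"
    unfolding \<Phi>_def
    by (intro rat_semilinear_all rat_semilinear_imp rat_semilinear_ball rat_semilinear.conj
        rat_semilinear_le rat_semilinear.pos rat_affine_diff rat_affine.const rat_affine.coord) auto
  moreover have "\<Phi> ((\<lambda>_. 0)(Scale := \<rho>)) \<longleftrightarrow>
      (\<forall>p\<in>half_open_unit_cube. \<exists>z\<in>Z. \<exists>y\<in>convex hull V. p = \<rho> *\<^sub>R y + z)" if \<rho>: "0 < \<rho>" for \<rho>
  proof -
    \<comment> \<open>The weights are bound inside \<open>\<Psi>\<close>, so only the scale and the
      point coordinates of the assignment matter.\<close>
    have \<Psi>_iff: "\<Psi> y \<longleftrightarrow> (\<exists>z\<in>Z. \<exists>h\<in>convex hull V. p = \<rho> *\<^sub>R h + z)"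
      if y: "y Scale = \<rho>" "\<And>i. y (Point i) = p $ i" for y and p :: "real ^ 'n"
    proof -
      have "(\<exists>w. (\<forall>k. k \<notin> Weight ` V \<longrightarrow> w k = y k) \<and> \<Theta> z w) \<longleftrightarrow>
        (\<exists>u. (\<forall>v\<in>V. 0 \<le> u v) \<and> sum u V = \<rho> \<and> (\<forall>i. (p - z) $ i = (\<Sum>v\<in>V. v $ i * u v)))" for z
      proof
        assume "\<exists>w. (\<forall>k. k \<notin> Weight ` V \<longrightarrow> w k = y k) \<and> \<Theta> z w"
        then obtain w where w: "\<forall>k. k \<notin> Weight ` V \<longrightarrow> w k = y k" "\<Theta> z w" by blast
        then have "w Scale = \<rho>" "\<And>i. w (Point i) = p $ i" using y by auto
        with w(2) show "\<exists>u. (\<forall>v\<in>V. 0 \<le> u v) \<and> sum u V = \<rho> \<and>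
            (\<forall>i. (p - z) $ i = (\<Sum>v\<in>V. v $ i * u v))"
          by (intro exI[of _ "\<lambda>v. w (Weight v)"]) (simp add: \<Theta>_def)
      next
        assume "\<exists>u. (\<forall>v\<in>V. 0 \<le> u v) \<and> sum u V = \<rho> \<and> (\<forall>i. (p - z) $ i = (\<Sum>v\<in>V. v $ i * u v))"
        then obtain u where u: "\<forall>v\<in>V. 0 \<le> u v" "sum u V = \<rho>"
          "\<forall>i. (p - z) $ i = (\<Sum>v\<in>V. v $ i * u v)" by blast
        \<comment> \<open>Only the weights of vertices may be changed; all other entries have to be
          those of \<open>y\<close>. The partial case expression is reached only for
          \<open>Weight\<close>, because of its guard.\<close>
        define w where "w k = (if k \<in> Weight ` V then case k of Weight v \<Rightarrow> u v else y k)" for k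
        have "w (Weight v) = u v" if "v \<in> V" for v using that by (simp add: w_def)
        moreover have "w Scale = \<rho>" "\<And>i. w (Point i) = p $ i" using y by (auto simp: w_def)
        ultimately have "\<Theta> z w" using u by (simp add: \<Theta>_def diff_eq_eq)
        moreover have "\<forall>k. k \<notin> Weight ` V \<longrightarrow> w k = y k" by (simp add: w_def)
        ultimately show "\<exists>w. (\<forall>k. k \<notin> Weight ` V \<longrightarrow> w k = y k) \<and> \<Theta> z w" by blast
      qed
      then show ?thesis
        unfolding \<Psi>_def mem_scaled_hull_iff[OF assms(1) \<rho>, symmetric] by (simp add: diff_eq_eq)
    qed
    show ?thesis
    proof
      assume \<Phi>: "\<Phi> ((\<lambda>_. 0)(Scale := \<rho>))"
      show "\<forall>p\<in>half_open_unit_cube. \<exists>z\<in>Z. \<exists>y\<in>convex hull V. p = \<rho> *\<^sub>R y + z"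
      proof
        fix p :: "real ^ 'n" assume p: "p \<in> half_open_unit_cube"
        \<comment> \<open>The weights are set to 0 because \<open>y\<close> must agree with the
          assignment \<open>(\<lambda>_. 0)(Scale := \<rho>)\<close> off the point
          coordinates.\<close>
        define y :: "('n, real ^ 'n) variable \<Rightarrow> real"
          where "y k = (case k of Scale \<Rightarrow> \<rho> | Point i \<Rightarrow> p $ i | Weight _ \<Rightarrow> 0)" for k
        have "\<forall>k. k \<notin> range Point \<longrightarrow> y k = ((\<lambda>_. 0)(Scale := \<rho>)) k"
          by (auto simp: y_def split: variable.splits)
        moreover have "\<forall>i\<in>UNIV. 0 \<le> y (Point i) \<and> 0 < 1 - y (Point i)"
          using p by (simp add: y_def half_open_unit_cube_def)
        ultimately have "\<Psi> y" using \<Phi> by (simp add: \<Phi>_def)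
        then show "\<exists>z\<in>Z. \<exists>y\<in>convex hull V. p = \<rho> *\<^sub>R y + z"
          by (subst (asm) \<Psi>_iff) (auto simp: y_def)
      qed
    next
      assume *: "\<forall>p\<in>half_open_unit_cube. \<exists>z\<in>Z. \<exists>y\<in>convex hull V. p = \<rho> *\<^sub>R y + z"
      show "\<Phi> ((\<lambda>_. 0)(Scale := \<rho>))"
        unfolding \<Phi>_def
      proof (intro allI impI)
        fix y :: "('n, real ^ 'n) variable \<Rightarrow> real"
        assume y: "\<forall>k. k \<notin> range Point \<longrightarrow> y k = ((\<lambda>_. 0)(Scale := \<rho>)) k"
          and "\<forall>i\<in>UNIV. 0 \<le> y (Point i) \<and> 0 < 1 - y (Point i)"
        then have "(\<chi> i. y (Point i)) \<in> half_open_unit_cube"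
          by (simp add: half_open_unit_cube_def)
        moreover have "y Scale = \<rho>" using y by auto
        ultimately show "\<Psi> y"
          using * \<Psi>_iff[of y "\<chi> i. y (Point i)"] by simp
      qed
    qed
  qed
  ultimately show ?thesis using that by blast
qed

text \<open>The witness is the midpoint of \<open>m\<close> and the largest element of
  \<open>A\<close> below it. Inserting 0 keeps the witness positive and lets the maximum exist even
  if no element of \<open>A\<close> lies below \<open>m\<close>.\<close>

lemma sgn_locally_constant:
  fixes m :: real
  assumes "finite A" "m \<notin> A" "0 < m"
  obtains t where "0 < t" "t < m" "\<forall>a\<in>A. sgn (t - a) = sgn (m - a)"
proof -
  define b where "b = Max (insert 0 {a \<in> A. a < m})"
  have fin: "finite (insert 0 {a \<in> A. a < m})" using assms by simp
  have b: "0 \<le> b" "\<And>a. a \<in> A \<Longrightarrow> a < m \<Longrightarrow> a \<le> b" "b < m"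
    unfolding b_def using fin assms(3) by auto
  have "sgn ((b + m) / 2 - a) = sgn (m - a)" if "a \<in> A" for a
  proof (cases "a < m")
    case True
    then show ?thesis using b that by (auto simp: sgn_if dest: b(2))
  next
    case False
    then have "m < a" using that assms(2) by (metis linorder_neqE)
    then show ?thesis using b by (simp add: sgn_if)
  qed
  then show ?thesis using that[of "(b + m) / 2"] b by simp
qed

text \<open>If the radius were not among the rational critical points, a smaller positive scale
  would have the same sign pattern and would also cover, against minimality.\<close>

lemma covering_radius_rational:
  fixes P :: "(real ^ 'n) set"
  assumes "rational_polytope P" "interior P \<noteq> {}"
  shows "covering_radius P \<in> \<rat>"
proof -
  obtain V where V: "finite V" "\<And>v i. v \<in> V \<Longrightarrow> v $ i \<in> \<rat>" and P: "P = convex hull V"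
    using assms(1) by (auto simp: rational_polytope_def)
  have "compact P" unfolding P by (intro finite_imp_compact_convex_hull V)
  note least = least_cover[OF this assms(2)]
  let ?m = "covering_radius P"
  obtain Z where Z: "finite Z" "Z \<subseteq> int_lattice" and cov: "\<And>\<rho>. 0 \<le> \<rho> \<Longrightarrow> \<rho> \<le> ?m \<Longrightarrow>
      covers P \<rho> \<longleftrightarrow> (\<forall>p\<in>half_open_unit_cube. \<exists>z\<in>Z. \<exists>y\<in>P. p = \<rho> *\<^sub>R y + z)"
    using covers_finite_lattice[OF compact_imp_bounded[OF \<open>compact P\<close>], where R = ?m] by metis
  obtain \<Phi> :: "(('n, real ^ 'n) variable \<Rightarrow> real) \<Rightarrow> bool" where "rat_semilinear \<Phi>"
    and \<Phi>: "\<And>\<rho>. 0 < \<rho> \<Longrightarrow> \<Phi> ((\<lambda>_. 0)(Scale := \<rho>)) \<longleftrightarrow>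
      (\<forall>p\<in>half_open_unit_cube. \<exists>z\<in>Z. \<exists>y\<in>P. p = \<rho> *\<^sub>R y + z)"
    using covering_condition_semilinear[OF V Z] unfolding P by blast
  then obtain A where A: "finite A" "A \<subseteq> \<rat>"
    and crit: "\<And>t u. (\<forall>a\<in>A. sgn (t - a) = sgn (u - a)) \<Longrightarrow>
      \<Phi> ((\<lambda>_. 0)(Scale := t)) = \<Phi> ((\<lambda>_. 0)(Scale := u))"
    using rat_semilinear_one_variable[of \<Phi> Scale] by metis
  have "?m \<in> A"
  proof (rule ccontr)
    assume "?m \<notin> A"
    then obtain t where t: "0 < t" "t < ?m" "\<forall>a\<in>A. sgn (t - a) = sgn (?m - a)"
      using sgn_locally_constant A(1) least(1) by blast
    then have "covers P t"
      using crit[OF t(3)] \<Phi> cov least(1,2) by simp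
    then show False using least(3) t by fastforce
  qed
  then show ?thesis using A(2) by blast
qed

section \<open>Denominators and the gap between rationals\<close>

lemma denominator_works:
  assumes "q \<in> \<rat>"
  shows "0 < denominator q" "real (denominator q) * q \<in> \<int>"
proof -
  obtain a b :: int where "q = of_int a / of_int b" "0 < b"
    using assms by (metis Rats_cases')
  then have "0 < nat b \<and> real (nat b) * q \<in> \<int>" by simp
  then have "0 < denominator q \<and> real (denominator q) * q \<in> \<int>"
    unfolding denominator_def by (rule LeastI)
  then show "0 < denominator q" "real (denominator q) * q \<in> \<int>" by auto
qed

text \<open>With \<open>k\<close> the denominator of \<open>q\<close>, the positive number
  \<open>k * s * (q - r / s)\<close> is an integer, so \<open>q - r / s\<close> is at least
  \<open>1 / (s * D)\<close>. Taking half of this keeps the inequality strict even if that bound is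
  attained.\<close>

lemma rational_gap:
  fixes r s D :: int
  assumes "q \<in> \<rat>" "int (denominator q) \<le> D" "0 < s" "of_int r / of_int s < q"
  shows "of_int r / of_int s + 1 / (2 * of_int s * of_int D) < q"
proof -
  let ?k = "real (denominator q)" and ?r = "real_of_int r" and ?s = "real_of_int s" and ?D = "real_of_int D"
  have k: "0 < ?k" "?k \<le> ?D" using denominator_works(1)[OF assms(1)] assms(2) by simp_all
  have s: "0 < ?s" using assms(3) by simp
  have "?k * ?s * (q - ?r / ?s) = ?s * (?k * q) - ?k * ?r"
    using s by (simp add: field_simps)
  also have "\<dots> \<in> \<int>"
    using denominator_works(2)[OF assms(1)] by (intro Ints_diff[OF Ints_mult Ints_mult]) auto
  finally have "1 \<le> ?k * ?s * (q - ?r / ?s)"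
    using Ints_nonzero_abs_ge1[of "?k * ?s * (q - ?r / ?s)"] k s assms(4) by (auto simp: abs_mult)
  also have "\<dots> \<le> ?D * ?s * (q - ?r / ?s)"
    using k s assms(4) by (intro mult_right_mono) auto
  finally have "1 / (?s * ?D) \<le> q - ?r / ?s"
    using k s by (simp add: pos_divide_le_eq mult_ac)
  moreover have "1 / (2 * ?s * ?D) < 1 / (?s * ?D)"
    using k s by (intro divide_strict_left_mono) auto
  ultimately show ?thesis by simp
qed

section \<open>Dyadic voxels\<close>

text \<open>The lower corners of the level-\<open>l\<close> voxels that tile the half-open unit
  cube. The subtraction is on natural numbers, where \<open>2 ^ l\<close> is at least 1 and nothing
  is truncated.\<close>

definition dyadic_grid :: "nat \<Rightarrow> (real ^ 'n) set" where
  "dyadic_grid l = (*\<^sub>R) (1 / 2 ^ l) ` {z. \<forall>i. z $ i \<in> real ` {0..2 ^ l - 1}}"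

lemma finite_dyadic_grid: "finite (dyadic_grid l)"
  unfolding dyadic_grid_def by (intro finite_imageI finite_vec_image finite_atLeastAtMost)

text \<open>The upper bound has the form \<open>z $ i + 1 \<le> 2 ^ l\<close> so that adding an
  offset below 1 stays strictly below \<open>2 ^ l\<close>.\<close>

lemma dyadic_gridE:
  assumes "c \<in> dyadic_grid l"
  obtains z where "z \<in> int_lattice" "c = (1 / 2 ^ l) *\<^sub>R z" "\<And>i. 0 \<le> z $ i" "\<And>i. z $ i + 1 \<le> 2 ^ l"
proof -
  obtain z where c: "c = (1 / 2 ^ l) *\<^sub>R z" and z: "\<And>i. z $ i \<in> real ` {0..2 ^ l - 1}"
    using assms by (auto simp: dyadic_grid_def)
  have "z $ i \<in> \<int> \<and> 0 \<le> z $ i \<and> z $ i + 1 \<le> 2 ^ l" for i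
  proof -
    obtain n where n: "n \<le> 2 ^ l - 1" and zi: "z $ i = real n" using z[of i] by auto
    have "n + 1 \<le> 2 ^ l" using n by (simp add: Suc_le_eq le_diff_conv2 flip: One_nat_def)
    then have "real (n + 1) \<le> real (2 ^ l)" by (subst of_nat_le_iff)
    then show ?thesis by (simp add: zi)
  qed
  then show ?thesis using that c by (auto simp: int_lattice_def)
qed

lemma dyadic_grid_decomp:
  assumes "x \<in> half_open_unit_cube"
  obtains c u where "c \<in> dyadic_grid l" "u \<in> half_open_unit_cube" "x = c + (1 / 2 ^ l) *\<^sub>R u"
proof -
  define u where "u = frac_vec (2 ^ l *\<^sub>R x)"
  define z where "z = 2 ^ l *\<^sub>R x - u"
  have "z $ i \<in> real ` {0..2 ^ l - 1}" for i
  proof -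
    have "0 \<le> 2 ^ l * x $ i" "2 ^ l * x $ i < 2 ^ l"
      using assms by (auto simp: half_open_unit_cube_def)
    then have k: "0 \<le> \<lfloor>2 ^ l * x $ i\<rfloor>" "\<lfloor>2 ^ l * x $ i\<rfloor> < 2 ^ l"
      by (simp_all add: floor_less_iff)
    then have "nat \<lfloor>2 ^ l * x $ i\<rfloor> < 2 ^ l" by (simp add: nat_less_iff)
    then have "nat \<lfloor>2 ^ l * x $ i\<rfloor> \<in> {0..2 ^ l - 1}"
      by (simp only: atLeastAtMost_iff) linarith
    moreover have "z $ i = real (nat \<lfloor>2 ^ l * x $ i\<rfloor>)"
      using k by (simp add: z_def u_def frac_vec_def frac_def)
    ultimately show ?thesis by (simp only: imageI)
  qed
  then have "(1 / 2 ^ l) *\<^sub>R z \<in> dyadic_grid l" by (auto simp: dyadic_grid_def)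
  moreover have "x = (1 / 2 ^ l) *\<^sub>R z + (1 / 2 ^ l) *\<^sub>R u"
    by (simp add: z_def flip: scaleR_add_right)
  ultimately show ?thesis using that frac_vec_in_cube unfolding u_def by blast
qed

lemma dyadic_grid_voxel_in_cube:
  assumes "c \<in> dyadic_grid l" "u \<in> half_open_unit_cube"
  shows "c + (1 / 2 ^ l) *\<^sub>R u \<in> half_open_unit_cube"
proof -
  obtain z where c: "c = (1 / 2 ^ l) *\<^sub>R z" and z: "\<And>i. 0 \<le> z $ i" "\<And>i. z $ i + 1 \<le> 2 ^ l"
    using dyadic_gridE[OF assms(1)] by metis
  have "0 \<le> u $ i \<and> u $ i < 1" for i
    using assms(2) by (simp add: half_open_unit_cube_def)
  then have "0 \<le> z $ i + u $ i" "z $ i + u $ i < 2 ^ l" for i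
    using z[of i] by (smt (verit))+
  then show ?thesis
    by (simp add: half_open_unit_cube_def c add_divide_distrib[symmetric])
qed

text \<open>After scaling by \<open>2 ^ l\<close> the corner is integral, so the offset is recovered
  as a fractional part.\<close>

lemma dyadic_grid_decomp_unique:
  assumes "c \<in> dyadic_grid l" "u \<in> half_open_unit_cube" "c' \<in> dyadic_grid l" "u' \<in> half_open_unit_cube"
    and eq: "c + (1 / 2 ^ l) *\<^sub>R u = c' + (1 / 2 ^ l) *\<^sub>R u'"
  shows "c = c'" "u = u'"
proof -
  obtain z z' where z: "z \<in> int_lattice" "c = (1 / 2 ^ l) *\<^sub>R z"
      "z' \<in> int_lattice" "c' = (1 / 2 ^ l) *\<^sub>R z'"
    using dyadic_gridE[OF assms(1)] dyadic_gridE[OF assms(3)] by metis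
  have "(1 / 2 ^ l) *\<^sub>R (z + u) = (1 / 2 ^ l :: real) *\<^sub>R (z' + u')"
    using eq z by (simp add: scaleR_add_right)
  then have "z + u = z' + u'" by simp
  moreover have "frac_vec (z + u) = u" "frac_vec (z' + u') = u'"
    using frac_vec_unique[OF assms(2), of "z + u"] frac_vec_unique[OF assms(4), of "z' + u'"] z by auto
  ultimately show "u = u'" by simp
  with eq show "c = c'" by simp
qed

lemma small_voxel:
  assumes "0 < \<delta>"
  shows "\<exists>l. \<forall>u\<in>half_open_unit_cube. norm ((1 / 2 ^ l) *\<^sub>R u :: real ^ 'n) < \<delta>"
proof -
  obtain l where "(1 / 2) ^ l < \<delta> / CARD('n)"
    using real_arch_pow_inv[of "\<delta> / CARD('n)" "1 / 2"] assms by auto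
  then have l: "1 / 2 ^ l * CARD('n) < \<delta>" by (simp add: field_simps)
  have "norm ((1 / 2 ^ l) *\<^sub>R u) < \<delta>" if "u \<in> half_open_unit_cube" for u :: "real ^ 'n"
    by (rule le_less_trans[OF norm_scaled_cube_le[OF that] l]) simp
  then show ?thesis by blast
qed

text \<open>The unit cube is cut into voxels of diameter small against \<open>\<delta>\<close>, and
  each is moved into \<open>S\<close> by a single integer vector chosen for its corner. Integer
  translations preserve cosets, so the moved pieces still meet every coset exactly once.\<close>

lemma dyadic_fundamental_domain_exists:
  fixes S :: "(real ^ 'n) set"
  assumes "0 < \<delta>" and "\<And>p. \<exists>z\<in>int_lattice. ball (p + z) \<delta> \<subseteq> S"
  shows "\<exists>F. dyadic_fundamental_domain F \<and> F \<subseteq> S"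
proof -
  obtain w where w: "\<And>p. w p \<in> int_lattice" "\<And>p. ball (p + w p) \<delta> \<subseteq> S"
    using assms(2) by metis
  obtain l where l: "\<And>u :: real ^ 'n. u \<in> half_open_unit_cube \<Longrightarrow> norm ((1 / 2 ^ l) *\<^sub>R u) < \<delta>"
    using small_voxel[OF assms(1)] by blast
  define Q where "Q c = (+) (c + w c) ` (*\<^sub>R) (1 / 2 ^ l) ` half_open_unit_cube" for c
  let ?F = "\<Union> (Q ` dyadic_grid l)"
  have F: "x \<in> ?F \<longleftrightarrow> (\<exists>c\<in>dyadic_grid l. \<exists>u\<in>half_open_unit_cube. x = c + w c + (1 / 2 ^ l) *\<^sub>R u)" for x
    by (auto simp: Q_def)
  have sub: "x \<in> S" if x: "x \<in> ?F" for x
  proof -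
    obtain c u where "u \<in> half_open_unit_cube" "x = c + w c + (1 / 2 ^ l) *\<^sub>R u"
      using x unfolding F by blast
    then have "x \<in> ball (c + w c) \<delta>" using l[of u] by (simp add: dist_norm)
    then show ?thesis using w(2) by blast
  qed
  have voxel: "dyadic_voxel l (Q c)" if "c \<in> dyadic_grid l" for c
  proof -
    obtain z where z: "z \<in> int_lattice" "c = (1 / 2 ^ l) *\<^sub>R z" using dyadic_gridE[OF \<open>c \<in> _\<close>] by metis
    \<comment> \<open>Integer vectors belong to the finer lattice of level \<open>l\<close>, so the
      moved corner is again an admissible voxel corner.\<close>
    have "2 ^ l *\<^sub>R w c \<in> int_lattice" using w(1)[of c] by (simp add: int_lattice_def)
    then have "z + 2 ^ l *\<^sub>R w c \<in> int_lattice" using z(1) by (rule add_in_int_lattice[rotated])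
    moreover have "c + w c = (1 / 2 ^ l) *\<^sub>R (z + 2 ^ l *\<^sub>R w c)"
      using z(2) by (simp add: scaleR_add_right)
    ultimately show ?thesis unfolding dyadic_voxel_def Q_def by blast
  qed
  have fundamental: "fundamental_domain ?F"
    unfolding fundamental_domain_def
  proof
    fix p :: "real ^ 'n"
    obtain c u where c: "c \<in> dyadic_grid l" and u: "u \<in> half_open_unit_cube"
      and p: "frac_vec p = c + (1 / 2 ^ l) *\<^sub>R u"
      using dyadic_grid_decomp[OF frac_vec_in_cube] .
    define x where "x = c + w c + (1 / 2 ^ l) *\<^sub>R u"
    have "w c - (p - frac_vec p) \<in> int_lattice"
      by (intro diff_in_int_lattice diff_frac_vec w)
    moreover have "x = p + (w c - (p - frac_vec p))" by (simp add: x_def p)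
    ultimately have "x \<in> (+) p ` int_lattice" by blast
    moreover have "x \<in> ?F" using c u unfolding F x_def by blast
    \<comment> \<open>Undoing the shift of its voxel sends \<open>x'\<close> to the point of the
      cube in the coset of \<open>p\<close>, which is \<open>frac_vec p\<close>; the unique
      decomposition of that point then fixes voxel and offset.\<close>
    moreover have "x' = x" if mem: "x' \<in> ?F \<inter> (+) p ` int_lattice" for x'
    proof -
      obtain c' u' where c': "c' \<in> dyadic_grid l" and u': "u' \<in> half_open_unit_cube"
        and x': "x' = c' + w c' + (1 / 2 ^ l) *\<^sub>R u'"
        using IntD1[OF mem] unfolding F by blast
      obtain z where z: "z \<in> int_lattice" "x' = p + z" using IntD2[OF mem] by blast
      have "p - (c' + (1 / 2 ^ l) *\<^sub>R u') = w c' - z" using x' z by (simp add: algebra_simps)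
      then have "p - (c' + (1 / 2 ^ l) *\<^sub>R u') \<in> int_lattice"
        using diff_in_int_lattice[OF w(1) z(1)] by simp
      then have "frac_vec p = c' + (1 / 2 ^ l) *\<^sub>R u'"
        by (intro frac_vec_unique dyadic_grid_voxel_in_cube c' u')
      then show ?thesis
        using dyadic_grid_decomp_unique[OF c u c' u'] p by (simp add: x_def x')
    qed
    ultimately show "\<exists>!x. x \<in> ?F \<inter> (+) p ` int_lattice"
      by (intro ex1I[of _ x] IntI)
  qed
  have "finite (Q ` dyadic_grid l)" by (intro finite_imageI finite_dyadic_grid)
  moreover have "\<forall>A\<in>Q ` dyadic_grid l. \<exists>l. dyadic_voxel l A" using voxel by blast
  ultimately have "dyadic_fundamental_domain ?F"
    using fundamental unfolding dyadic_fundamental_domain_def by blast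
  then show ?thesis using sub by (intro exI[of _ ?F] conjI subsetI)
qed

text \<open>The sum of a compact and a closed set is closed, so the uncovered set is open. The
  corner of a sufficiently small voxel around an uncovered point is uncovered too.\<close>

lemma dyadic_point_avoiding:
  fixes S :: "(real ^ 'n) set"
  assumes "compact S" "S + int_lattice \<noteq> UNIV"
  shows "\<exists>l. \<exists>c\<in>dyadic_grid l. S \<inter> (+) c ` int_lattice = {}"
proof -
  have "closed (\<Union>x\<in>S. \<Union>y\<in>int_lattice. {x + y})"
    by (intro compact_closed_sums assms closed_int_lattice)
  also have "(\<Union>x\<in>S. \<Union>y\<in>int_lattice. {x + y}) = S + int_lattice"
    by (auto simp: set_plus_def)
  finally have "open (- (S + int_lattice))" by (simp add: open_closed)
  obtain p where "p \<notin> S + int_lattice" using assms(2) by blast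
  \<comment> \<open>Moving to the representative in the unit cube is possible by periodicity and
    ensures that the corner found belongs to \<open>dyadic_grid\<close>.\<close>
  have "frac_vec p \<notin> S + int_lattice"
  proof
    assume "frac_vec p \<in> S + int_lattice"
    then obtain x z where "x \<in> S" "z \<in> int_lattice" "frac_vec p = x + z" by (auto elim: set_plus_elim)
    then have "x + (z + (p - frac_vec p)) \<in> S + int_lattice"
      by (intro set_plus_intro add_in_int_lattice diff_frac_vec)
    then show False using \<open>p \<notin> _\<close> \<open>frac_vec p = x + z\<close> by (simp add: algebra_simps)
  qed
  then obtain \<delta> where "0 < \<delta>" and \<delta>: "ball (frac_vec p) \<delta> \<subseteq> - (S + int_lattice)"
    using \<open>open _\<close> by (meson ComplI openE)
  obtain l where l: "\<And>u :: real ^ 'n. u \<in> half_open_unit_cube \<Longrightarrow> norm ((1 / 2 ^ l) *\<^sub>R u) < \<delta>"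
    using small_voxel[OF \<open>0 < \<delta>\<close>] by blast
  obtain c u where c: "c \<in> dyadic_grid l" and u: "u \<in> half_open_unit_cube"
    and p: "frac_vec p = c + (1 / 2 ^ l) *\<^sub>R u"
    using dyadic_grid_decomp[OF frac_vec_in_cube] .
  have "c \<in> ball (frac_vec p) \<delta>" using l[OF u] by (simp add: p dist_norm)
  then have "c \<notin> S + int_lattice" using \<delta> by blast
  moreover have "c \<in> S + int_lattice" if "z \<in> int_lattice" "c + z \<in> S" for z
    using set_plus_intro[OF that(2) diff_in_int_lattice[OF zero_in_int_lattice that(1)]] by simp
  ultimately show ?thesis using c by (intro exI[of _ l] bexI[of _ c]) auto
qed

section \<open>The two alternatives for the enlarged polytope\<close>

theorem theorem3p6:
  fixes P Pplus :: "(real ^ 'n) set" and D r s :: int and \<rho> :: real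
  assumes "rational_polytope P"
    and "interior P \<noteq> {}"
    and "1 \<le> D"
    and "int (denominator (covering_radius P)) \<le> D"
    and "0 < s"
    and "\<rho> = of_int r / of_int s"
    and "0 < \<rho>"
    and "Pplus = (*\<^sub>R) (\<rho> + 1 / (2 * of_int s * of_int D)) ` P"
  shows "(covering_radius P \<le> \<rho> \<longrightarrow>
            (\<exists>F. dyadic_fundamental_domain F \<and> F \<subseteq> Pplus)) \<and>
         (\<rho> < covering_radius P \<longrightarrow>
            (\<exists>(l::nat) c.
               c \<in> (*\<^sub>R) (1 / 2 ^ l) ` {z. \<forall>i. z $ i \<in> real ` {0..2 ^ l - 1}} \<and>
               Pplus \<inter> (+) c ` int_lattice = {}))"
proof -
  have "compact P" "convex P"
    using assms(1) by (auto simp: rational_polytope_def intro: finite_imp_compact_convex_hull)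
  note radius = least_cover[OF \<open>compact P\<close> assms(2)]
  define \<epsilon> where "\<epsilon> = 1 / (2 * real_of_int s * real_of_int D)"
  have \<epsilon>: "0 < \<epsilon>" using assms(3,5) by (simp add: \<epsilon>_def)
  have Pplus: "Pplus = (*\<^sub>R) (\<rho> + \<epsilon>) ` P" using assms(8) by (simp add: \<epsilon>_def)
  show ?thesis
  proof (intro conjI impI)
    assume "covering_radius P \<le> \<rho>"
    \<comment> \<open>The summand \<open>\<epsilon>\<close> leaves a positive margin for thickening
      even in the boundary case where the covering radius equals \<open>\<rho>\<close>.\<close>
    then have "0 < \<rho> + \<epsilon> - covering_radius P" using \<epsilon> by simp
    then obtain \<delta> where "0 < \<delta>" and "\<And>p. \<exists>z\<in>int_lattice. ball (p + z) \<delta> \<subseteq>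
        (*\<^sub>R) (covering_radius P + (\<rho> + \<epsilon> - covering_radius P)) ` P"
      using covers_thicken[OF \<open>convex P\<close> assms(2) less_imp_le[OF radius(1)] _ radius(2)] by blast
    then have "\<And>p. \<exists>z\<in>int_lattice. ball (p + z) \<delta> \<subseteq> Pplus" by (simp add: Pplus)
    with \<open>0 < \<delta>\<close> show "\<exists>F. dyadic_fundamental_domain F \<and> F \<subseteq> Pplus"
      by (rule dyadic_fundamental_domain_exists)
  next
    assume "\<rho> < covering_radius P"
    \<comment> \<open>Here the rationality of the radius and the bound \<open>D\<close> on its
      denominator enter; minimality of the radius then excludes covering at the enlarged
      scale.\<close>
    then have "\<rho> + \<epsilon> < covering_radius P"
      using rational_gap[OF covering_radius_rational[OF assms(1,2)] assms(4,5)]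
      by (simp add: \<epsilon>_def assms(6))
    then have "\<not> covers P (\<rho> + \<epsilon>)" using radius(3)[of "\<rho> + \<epsilon>"] \<epsilon> assms(7) by auto
    then have "Pplus + int_lattice \<noteq> UNIV" by (simp add: covers_iff Pplus)
    moreover have "compact Pplus" unfolding Pplus by (intro compact_scaling \<open>compact P\<close>)
    ultimately obtain l c where "c \<in> dyadic_grid l" "Pplus \<inter> (+) c ` int_lattice = {}"
      using dyadic_point_avoiding by blast
    then show "\<exists>(l::nat) c.
        c \<in> (*\<^sub>R) (1 / 2 ^ l) ` {z. \<forall>i. z $ i \<in> real ` {0..2 ^ l - 1}} \<and>
        Pplus \<inter> (+) c ` int_lattice = {}"
      unfolding dyadic_grid_def by (intro exI conjI)
  qed
qed

end
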